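(* Any partial $(K_v,P_4)$-design can be embedded into a $(K_n,P_4)$-design for any admissible $n\geq v+2$.
   Context: $K_n$ is the complete graph on $n$ vertices and $P_4$ is the path with $4$ vertices and $3$ edges. A $(K_n,P_4)$-design is a set of subgraphs of $K_n$, each isomorphic to $P_4$, whose edge sets partition $E(K_n)$. An integer $n$ is admissible if a $(K_n,P_4)$-design exists. A partial $(K_v,P_4)$-design is a set of pairwise edge-disjoint subgraphs of $K_v$, each isomorphic to $P_4$. A partial $(K_v,P_4)$-design $\mathcal B$ is embedded into a $(K_n,P_4)$-design $\mathcal B'$ if $V(K_v)\subseteq V(K_n)$ and $\mathcal B\subseteq\mathcal B'$. *)

theory Defs
  imports Main
begin

text \<open>Undirected graphs; an edge is the two-element set of its endpoints.\<close>

datatype 'a graph = Graph (verts: "'a set") (edges: "'a set set")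

definition simple_graph :: "'a graph \<Rightarrow> bool" where
  "simple_graph G \<longleftrightarrow> (\<forall>e\<in>edges G. e \<subseteq> verts G \<and> card e = 2)"

definition subgraph :: "'a graph \<Rightarrow> 'a graph \<Rightarrow> bool" where
  "subgraph H G \<longleftrightarrow> simple_graph H \<and> verts H \<subseteq> verts G \<and> edges H \<subseteq> edges G"

definition isomorphic :: "'a graph \<Rightarrow> 'b graph \<Rightarrow> bool" where
  "isomorphic G H \<longleftrightarrow>
     (\<exists>f. bij_betw f (verts G) (verts H) \<and> edges H = (\<lambda>e. f ` e) ` edges G)"

definition complete_graph :: "'a set \<Rightarrow> 'a graph" where
  "complete_graph V = Graph V {e. e \<subseteq> V \<and> card e = 2}"

definition path_graph :: "nat \<Rightarrow> nat graph" where
  "path_graph m = Graph {..<m} {{i, Suc i} | i. Suc i < m}"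

definition partial_design :: "'a graph \<Rightarrow> 'b graph \<Rightarrow> 'a graph set \<Rightarrow> bool" where
  "partial_design G H \<B> \<longleftrightarrow>
     (\<forall>S\<in>\<B>. subgraph S G \<and> isomorphic S H) \<and>
     pairwise (\<lambda>S T. disjnt (edges S) (edges T)) \<B>"

definition design :: "'a graph \<Rightarrow> 'b graph \<Rightarrow> 'a graph set \<Rightarrow> bool" where
  "design G H \<B> \<longleftrightarrow> partial_design G H \<B> \<and> (\<Union>S\<in>\<B>. edges S) = edges G"

text \<open>Existence of a design of \<open>K\<^sub>n\<close> does not depend on the choice of the \<open>n\<close> vertices, so
  admissibility is stated on \<open>{0, \<dots>, n - 1}\<close>.\<close>

definition admissible :: "nat \<Rightarrow> bool" where
  "admissible n \<longleftrightarrow> (\<exists>\<B>. design (complete_graph {..<n}) (path_graph 4) \<B>)"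

definition embedded :: "'a graph \<Rightarrow> 'a graph set \<Rightarrow> 'a graph \<Rightarrow> 'a graph set \<Rightarrow> bool" where
  "embedded G \<B> G' \<B>' \<longleftrightarrow> verts G \<subseteq> verts G' \<and> \<B> \<subseteq> \<B>'"

end

theory Submission
  imports Defs
begin

text \<open>Pick two vertices \<open>a\<close>, \<open>b\<close> of \<open>W - V\<close> and let \<open>H\<close> be the graph of uncovered edges on the
  remaining vertices \<open>M\<close>: it suffices to decompose the join of \<open>H\<close> with the edge \<open>ab\<close>, whose
  number of edges is divisible by 3. Paths inside \<open>H\<close> may be removed, so the components of \<open>H\<close> are
  stars and triangles. A triangle and its 6 edges to \<open>a\<close>, \<open>b\<close> form three paths; two
  leaves of a star, with their edges to the centre and to \<open>a\<close>, \<open>b\<close>, form two paths. Removing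
  these reduces \<open>H\<close> to a matching. By divisibility the number of components is then 1 modulo 3, any three components together with their edges to \<open>a\<close>, \<open>b\<close> are decomposable,
  and the edge \<open>ab\<close> is absorbed by a component that is an edge or by four isolated vertices. The
  only obstruction, \<open>H\<close> being reduced to one vertex, is avoided by treating the last
  reduction step together with \<open>ab\<close>; \<open>card M = 1\<close> itself is excluded since 3 is not
  admissible.\<close>

section \<open>Edge sets that split into paths with three edges\<close>

text \<open>Paths are kept as bare edge sets; their vertex sets are restored only when blocks are
  built. The clause \<open>union\<close> is symmetric, so decompositions of disjoint parts can be
  glued directly.\<close>

inductive decomposable :: "'a set set \<Rightarrow> bool" where
  empty: "decomposable {}"
| path: "distinct [w, x, y, z] \<Longrightarrow> decomposable {{w, x}, {x, y}, {y, z}}"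
| union: "\<lbrakk>decomposable A; decomposable B; disjnt A B\<rbrakk> \<Longrightarrow> decomposable (A \<union> B)"

text \<open>Shaped for explicitly listed edge sets: repeated backward use cuts the list into
  consecutive triples. This is why the enumerations below list their edges path by path.\<close>

lemma decomposable_insert3:
  assumes "decomposable A" "distinct [w, x, y, z]" "{w, x} \<notin> A" "{x, y} \<notin> A" "{y, z} \<notin> A"
  shows "decomposable (insert {w, x} (insert {x, y} (insert {y, z} A)))"
  using decomposable.union[OF decomposable.path[OF assms(2)] assms(1)] assms(3-)
  by (simp add: disjnt_def)

section \<open>Joining two vertices to a vertex set\<close>

text \<open>For distinct \<open>a\<close>, \<open>b\<close> outside \<open>M\<close> this is the
  edge set of the complete bipartite graph with sides \<open>{a, b}\<close> and
  \<open>M\<close>.\<close>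

definition cone :: "'a \<Rightarrow> 'a \<Rightarrow> 'a set \<Rightarrow> 'a set set" where
  "cone a b M = {{a, x} | x. x \<in> M} \<union> {{b, x} | x. x \<in> M}"

lemma cone_empty [simp]: "cone a b {} = {}"
  by (simp add: cone_def)

lemma cone_insert [simp]: "cone a b (insert x M) = insert {a, x} (insert {b, x} (cone a b M))"
  by (auto simp: cone_def)

lemma cone_Un: "cone a b (M \<union> N) = cone a b M \<union> cone a b N"
  by (auto simp: cone_def)

lemma cone_disjnt:
  assumes "disjnt M N" "a \<notin> M \<union> N" "b \<notin> M \<union> N"
  shows "disjnt (cone a b M) (cone a b N)"
  using assms by (auto simp: cone_def disjnt_iff doubleton_eq_iff)

lemma mem_cone_iff:
  assumes "a \<notin> M" "b \<notin> M" "a \<noteq> b"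
  shows "{x, y} \<in> cone a b M \<longleftrightarrow> x \<in> {a, b} \<and> y \<in> M \<or> y \<in> {a, b} \<and> x \<in> M"
  using assms by (auto simp: cone_def doubleton_eq_iff)

lemma card_cone:
  assumes "finite M" "a \<notin> M" "b \<notin> M" "a \<noteq> b"
  shows "finite (cone a b M)" and "card (cone a b M) = 2 * card M"
proof -
  have eq: "cone a b M = (\<lambda>x. {a, x}) ` M \<union> (\<lambda>x. {b, x}) ` M"
    by (auto simp: cone_def)
  show "finite (cone a b M)" using assms by (simp add: eq)
  have "card ((\<lambda>x. {a, x}) ` M) = card M" "card ((\<lambda>x. {b, x}) ` M) = card M"
    by (auto intro!: card_image simp: inj_on_def doubleton_eq_iff)
  moreover have "(\<lambda>x. {a, x}) ` M \<inter> (\<lambda>x. {b, x}) ` M = {}"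
    using assms by (auto simp: doubleton_eq_iff)
  ultimately show "card (cone a b M) = 2 * card M"
    using assms by (simp add: eq card_Un_disjoint)
qed

text \<open>The members of \<open>\<C>\<close>, of size 1 or 2, stand for the components of a graph of maximum
  degree at most 1.\<close>

definition join_components :: "'a \<Rightarrow> 'a \<Rightarrow> 'a set set \<Rightarrow> 'a set set" where
  "join_components a b \<C> = {C \<in> \<C>. card C = 2} \<union> cone a b (\<Union>\<C>)"

lemma join_components_empty [simp]: "join_components a b {} = {}"
  by (simp add: join_components_def)

lemma join_components_insert_single [simp]:
  "join_components a b (insert {x} \<C>) = insert {a, x} (insert {b, x} (join_components a b \<C>))"
  by (auto simp: join_components_def)

lemma join_components_insert_edge [simp]:
  assumes "x \<noteq> y"
  shows "join_components a b (insert {x, y} \<C>) =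
    insert {x, y} (insert {a, x} (insert {b, x} (insert {a, y} (insert {b, y} (join_components a b \<C>)))))"
proof -
  have "{C \<in> insert {x, y} \<C>. card C = 2} = insert {x, y} {C \<in> \<C>. card C = 2}"
    using assms by auto
  then show ?thesis by (simp add: join_components_def insert_commute)
qed

lemma join_components_Un:
  "join_components a b (\<C> \<union> \<D>) = join_components a b \<C> \<union> join_components a b \<D>"
  by (auto simp: join_components_def cone_Un)

lemma edge_notin_cone:
  assumes "e \<inter> {a, b} = {}" shows "e \<notin> cone a b M"
  using assms by (auto simp: cone_def)

lemma join_components_disjnt:
  assumes "disjnt (\<Union>\<C>) (\<Union>\<D>)" "a \<notin> \<Union>(\<C> \<union> \<D>)" "b \<notin> \<Union>(\<C> \<union> \<D>)"
  shows "disjnt (join_components a b \<C>) (join_components a b \<D>)"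
proof -
  have "disjnt (cone a b (\<Union>\<C>)) (cone a b (\<Union>\<D>))"
    by (rule cone_disjnt) (use assms in auto)
  moreover have "e \<notin> cone a b M" if "e \<in> \<C> \<union> \<D>" for e M
    by (rule edge_notin_cone) (use that assms in auto)
  \<comment> \<open>A common member would lie in both unions, which are disjoint, so it would be
    empty and could not have size 2.\<close>
  moreover have "e \<notin> \<D>" if "e \<in> \<C>" "card e = 2" for e
  proof
    assume "e \<in> \<D>"
    then have "e = {}" using assms(1) that by (auto simp: disjnt_iff)
    then show False using that by simp
  qed
  ultimately show ?thesis
    unfolding join_components_def disjnt_iff by blast
qed

section \<open>Joins over components with at most two vertices\<close>

text \<open>The two paths are \<open>x a y b\<close> and \<open>a z b x\<close>.\<close>

lemma join_single3:
  assumes "distinct [a, b, x, y, z]"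
  shows "decomposable (join_components a b {{x}, {y}, {z}})"
proof -
  have "decomposable {{x, a}, {a, y}, {y, b}, {a, z}, {z, b}, {b, x}}"
    using assms by (intro decomposable_insert3 decomposable.empty) (auto simp: doubleton_eq_iff)
  also have "{{x, a}, {a, y}, {y, b}, {a, z}, {z, b}, {b, x}} = join_components a b {{x}, {y}, {z}}"
    by (simp add: insert_commute)
  finally show ?thesis .
qed

text \<open>The three paths are \<open>a x y b\<close>, \<open>y a u b\<close> and
  \<open>a v b x\<close>.\<close>

lemma join_edge_single2:
  assumes "distinct [a, b, x, y, u, v]"
  shows "decomposable (join_components a b {{x, y}, {u}, {v}})"
proof -
  have "decomposable {{a, x}, {x, y}, {y, b}, {y, a}, {a, u}, {u, b}, {a, v}, {v, b}, {b, x}}"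
    using assms by (intro decomposable_insert3 decomposable.empty) (auto simp: doubleton_eq_iff)
  also have "\<dots> = join_components a b {{x, y}, {u}, {v}}"
    using assms by simp (simp add: insert_commute)
  finally show ?thesis .
qed

text \<open>The four paths are \<open>a u b w\<close>, \<open>a w z b\<close>,
  \<open>a x b y\<close> and \<open>x y a z\<close>.\<close>

lemma join_edge2_single:
  assumes "distinct [a, b, x, y, z, w, u]"
  shows "decomposable (join_components a b {{x, y}, {z, w}, {u}})"
proof -
  have "decomposable {{a, u}, {u, b}, {b, w}, {a, w}, {w, z}, {z, b},
      {a, x}, {x, b}, {b, y}, {x, y}, {y, a}, {a, z}}"
    using assms by (intro decomposable_insert3 decomposable.empty) (auto simp: doubleton_eq_iff)
  also have "\<dots> = join_components a b {{x, y}, {z, w}, {u}}"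
    using assms by simp (simp add: insert_commute)
  finally show ?thesis .
qed

text \<open>The five paths are \<open>a s b t\<close>, \<open>s t a w\<close>,
  \<open>a x b w\<close>, \<open>w z a y\<close> and \<open>x y b z\<close>.\<close>

lemma join_edge3:
  assumes "distinct [a, b, x, y, z, w, s, t]"
  shows "decomposable (join_components a b {{x, y}, {z, w}, {s, t}})"
proof -
  have "decomposable {{a, s}, {s, b}, {b, t}, {s, t}, {t, a}, {a, w},
      {a, x}, {x, b}, {b, w}, {w, z}, {z, a}, {a, y}, {x, y}, {y, b}, {b, z}}"
    using assms by (intro decomposable_insert3 decomposable.empty) (auto simp: doubleton_eq_iff)
  also have "\<dots> = join_components a b {{x, y}, {z, w}, {s, t}}"
    using assms by simp (simp add: insert_commute)
  finally show ?thesis .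
qed

text \<open>A component contributes 2 or 5 edges, in either case 2 modulo 3, so components have to
  be treated in threes. Up to order only the number of edge components matters, which leaves the
  four configurations above.\<close>

lemma join_three_components:
  assumes "pairwise disjnt {A, B, C}" "A \<noteq> B" "A \<noteq> C" "B \<noteq> C"
    and card: "\<forall>D\<in>{A, B, C}. card D \<in> {1, 2}"
    and ab: "a \<notin> A \<union> B \<union> C" "b \<notin> A \<union> B \<union> C" "a \<noteq> b"
  shows "decomposable (join_components a b {A, B, C})"
proof -
  have disj: "disjnt A B" "disjnt A C" "disjnt B C"
    using assms by (auto simp: pairwise_def)
  have form: "(\<exists>x. D = {x}) \<or> (\<exists>x y. x \<noteq> y \<and> D = {x, y})" if "D \<in> {A, B, C}" for D
  proof -
    from card that have "card D = 1 \<or> card D = 2" by blast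
    then show ?thesis by (metis card_1_singletonE card_2_iff)
  qed
  \<comment> \<open>Reorderings that put the edge components first, as the four explicit
    decompositions expect.\<close>
  have comm: "{A, B, C} = {A, C, B}" "{A, B, C} = {B, A, C}" "{A, B, C} = {B, C, A}"
    "{A, B, C} = {C, A, B}" by auto
  consider (s) x where "A = {x}" | (e) x y where "x \<noteq> y" "A = {x, y}" using form[of A] by blast
  then show ?thesis
  proof cases
    case As: s
    consider (s) u where "B = {u}" | (e) u v where "u \<noteq> v" "B = {u, v}" using form[of B] by blast
    then show ?thesis
    proof cases
      case Bs: s
      consider (s) p where "C = {p}" | (e) p q where "p \<noteq> q" "C = {p, q}" using form[of C] by blast
      then show ?thesis
      proof cases
        case s
        show ?thesis unfolding As Bs s by (rule join_single3) (use As Bs s disj ab in auto)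
      next
        case e
        have "decomposable (join_components a b {C, A, B})"
          unfolding As Bs e(2) by (rule join_edge_single2) (use As Bs e disj ab in auto)
        then show ?thesis by (simp add: comm(4))
      qed
    next
      case Be: e
      consider (s) p where "C = {p}" | (e) p q where "p \<noteq> q" "C = {p, q}" using form[of C] by blast
      then show ?thesis
      proof cases
        case s
        have "decomposable (join_components a b {B, A, C})"
          unfolding As Be(2) s by (rule join_edge_single2) (use As Be s disj ab in auto)
        then show ?thesis by (simp add: comm(2))
      next
        case e
        have "decomposable (join_components a b {B, C, A})"
          unfolding As Be(2) e(2) by (rule join_edge2_single) (use As Be e disj ab in auto)
        then show ?thesis by (simp add: comm(3))
      qed
    qed
  next
    case Ae: e
    consider (s) u where "B = {u}" | (e) u v where "u \<noteq> v" "B = {u, v}" using form[of B] by blast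
    then show ?thesis
    proof cases
      case Bs: s
      consider (s) p where "C = {p}" | (e) p q where "p \<noteq> q" "C = {p, q}" using form[of C] by blast
      then show ?thesis
      proof cases
        case s
        show ?thesis unfolding Ae(2) Bs s by (rule join_edge_single2) (use Ae Bs s disj ab in auto)
      next
        case e
        have "decomposable (join_components a b {A, C, B})"
          unfolding Ae(2) Bs e(2) by (rule join_edge2_single) (use Ae Bs e disj ab in auto)
        then show ?thesis by (simp add: comm(1))
      qed
    next
      case Be: e
      consider (s) p where "C = {p}" | (e) p q where "p \<noteq> q" "C = {p, q}" using form[of C] by blast
      then show ?thesis
      proof cases
        case s
        show ?thesis unfolding Ae(2) Be(2) s by (rule join_edge2_single) (use Ae Be s disj ab in auto)
      next
        case e
        show ?thesis unfolding Ae(2) Be(2) e(2) by (rule join_edge3) (use Ae Be e disj ab in auto)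
      qed
    qed
  qed
qed

text \<open>Induction on the number of components, splitting off three at a time.\<close>

lemma join_components_decomposable:
  assumes "finite \<C>" "pairwise disjnt \<C>" "\<forall>C\<in>\<C>. card C \<in> {1, 2}" "3 dvd card \<C>"
    and "a \<notin> \<Union>\<C>" "b \<notin> \<Union>\<C>" "a \<noteq> b"
  shows "decomposable (join_components a b \<C>)"
  using assms(1-6)
proof (induction "card \<C>" arbitrary: \<C> rule: less_induct)
  case less
  show ?case
  proof (cases "\<C> = {}")
    case True
    then show ?thesis by (simp add: join_components_def decomposable.empty)
  next
    case False
    then have "card \<C> \<noteq> 0" using less.prems by simp
    then have "3 \<le> card \<C>" using less.prems by presburger
    then obtain \<T> where T: "\<T> \<subseteq> \<C>" "card \<T> = 3" using obtain_subset_with_card_n by metis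
    then obtain A B C where ABC: "\<T> = {A, B, C}" "A \<noteq> B" "A \<noteq> C" "B \<noteq> C"
      by (auto simp: card_3_iff)
    have fin: "finite \<T>" using T less.prems finite_subset by blast
    have card: "card (\<C> - \<T>) = card \<C> - 3" using T fin by (simp add: card_Diff_subset)
    have disj: "disjnt (\<Union>\<T>) (\<Union>(\<C> - \<T>))"
      using less.prems(2) T(1) by (fastforce simp: pairwise_def disjnt_iff)
    have "decomposable (join_components a b \<T>)"
      unfolding ABC(1)
      by (rule join_three_components)
        (use ABC T less.prems assms(7) in \<open>auto simp: pairwise_def\<close>)
    moreover have "decomposable (join_components a b (\<C> - \<T>))"
    proof (rule less.hyps)
      show "card (\<C> - \<T>) < card \<C>" using card \<open>3 \<le> card \<C>\<close> by simp
      show "3 dvd card (\<C> - \<T>)" using card \<open>3 \<le> card \<C>\<close> less.prems by (simp add: dvd_diff_nat)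
      show "pairwise disjnt (\<C> - \<T>)" using less.prems(2) by (auto simp: pairwise_def)
    qed (use less.prems in auto)
    moreover have "disjnt (join_components a b \<T>) (join_components a b (\<C> - \<T>))"
      by (rule join_components_disjnt) (use disj less.prems T in auto)
    ultimately have "decomposable (join_components a b (\<T> \<union> (\<C> - \<T>)))"
      unfolding join_components_Un by (rule decomposable.union)
    then show ?thesis using T by (simp add: Un_absorb1)
  qed
qed

text \<open>There are \<open>card M - card E\<close> components, and
  \<open>card E + 2 * card M + 1\<close> is congruent to twice that number plus 1. Divisibility by 3
  thus forces the number to be 1 modulo 3. Some 1 modulo 3 of the components absorb the edge
  \<open>ab\<close>, and the others fall into threes.\<close>

lemma join_matching_decomposable:
  assumes "finite M" "\<forall>e\<in>E. e \<subseteq> M \<and> card e = 2" "pairwise disjnt E"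
    and "a \<notin> M" "b \<notin> M" "a \<noteq> b" "2 \<le> card M" "3 dvd card E + 2 * card M + 1"
  shows "decomposable (insert {a, b} (E \<union> cone a b M))"
proof -
  \<comment> \<open>Vertices missed by the matching become singletons, so that \<C> partitions
    \<open>M\<close>.\<close>
  define \<C> where "\<C> = E \<union> (\<lambda>x. {x}) ` (M - \<Union>E)"
  have finE: "finite E" by (rule finite_subset[of _ "Pow M"]) (use assms in auto)
  have UC: "\<Union>\<C> = M" using assms(2) by (auto simp: \<C>_def)
  have EC: "{C \<in> \<C>. card C = 2} = E" using assms(2) by (auto simp: \<C>_def)
  have finC: "finite \<C>" using finE assms(1) by (simp add: \<C>_def)
  have disjC: "pairwise disjnt \<C>"
    using assms(3) by (auto simp: \<C>_def pairwise_def disjnt_iff)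
  have cardC: "\<forall>C\<in>\<C>. card C \<in> {1, 2}" using assms(2) by (auto simp: \<C>_def)
  have "card \<C> = card E + card (M - \<Union>E)"
  proof -
    have "card ((\<lambda>x. {x}) ` (M - \<Union>E)) = card (M - \<Union>E)" by (simp add: card_image)
    moreover have "E \<inter> (\<lambda>x. {x}) ` (M - \<Union>E) = {}" by auto
    ultimately show ?thesis using finE assms(1) by (simp add: \<C>_def card_Un_disjoint)
  qed
  moreover have "card M = 2 * card E + card (M - \<Union>E)"
  proof -
    have "card (\<Union>E) = sum card E"
      using assms by (intro card_Union_disjoint) (auto intro: finite_subset)
    also have "\<dots> = 2 * card E" using assms(2) by simp
    finally have "card (\<Union>E) = 2 * card E" .
    moreover have "card M = card (\<Union>E) + card (M - \<Union>E)"
    proof -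
      have "\<Union>E \<subseteq> M" using assms(2) by auto
      then show ?thesis using assms(1)
        by (metis card_Diff_subset card_mono finite_subset le_add_diff_inverse)
    qed
    ultimately show ?thesis by simp
  qed
  ultimately have mod: "card \<C> mod 3 = 1" using assms(8) by presburger
  obtain \<T> where T: "\<T> \<subseteq> \<C>" "card \<T> mod 3 = 1"
    "decomposable (insert {a, b} (join_components a b \<T>))"
  proof (cases "E = {}")
    case False
    then obtain e where e: "e \<in> E" by blast
    then obtain x y where xy: "e = {x, y}" "x \<noteq> y" using assms(2) by (meson card_2_iff)
    \<comment> \<open>One edge component absorbs \<open>ab\<close> by the paths
      \<open>a x y b\<close> and \<open>y a b x\<close>.\<close>
    have "decomposable {{a, x}, {x, y}, {y, b}, {y, a}, {a, b}, {b, x}}"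
      using assms(2,4-6) e xy
      by (intro decomposable_insert3 decomposable.empty) (auto simp: doubleton_eq_iff)
    also have "\<dots> = insert {a, b} (join_components a b {e})"
      using xy by (simp add: insert_commute)
    finally show ?thesis using that[of "{e}"] e by (simp add: \<C>_def)
  next
    case True
    \<comment> \<open>Without edges, divisibility makes \<open>card M\<close> congruent to 1 modulo
      3. The value 1 is ruled out by hypothesis; there the join would be a triangle.\<close>
    then have "4 \<le> card M" using assms(7,8) by (simp) presburger
    then obtain S where S: "S \<subseteq> M" "card S = 4" using obtain_subset_with_card_n by metis
    then obtain x y z u where xyzu: "S = {x, y, z, u}" "distinct [x, y, z, u]"
      by (auto simp: numeral_eq_Suc card_Suc_eq)
    \<comment> \<open>The paths are \<open>u a b x\<close>, \<open>b y a x\<close> and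
      \<open>a z b u\<close>.\<close>
    have "decomposable {{u, a}, {a, b}, {b, x}, {b, y}, {y, a}, {a, x}, {a, z}, {z, b}, {b, u}}"
      using assms(4-6) S xyzu
      by (intro decomposable_insert3 decomposable.empty) (auto simp: doubleton_eq_iff)
    also have "\<dots> = insert {a, b} (join_components a b {{x}, {y}, {z}, {u}})"
      by (simp add: insert_commute)
    finally show ?thesis using that[of "{{x}, {y}, {z}, {u}}"] S xyzu True
      by (auto simp: \<C>_def)
  qed
  have "decomposable (join_components a b (\<C> - \<T>))"
  proof (rule join_components_decomposable)
    have "card (\<C> - \<T>) = card \<C> - card \<T>" "card \<T> \<le> card \<C>"
      using T finC by (auto simp: card_Diff_subset finite_subset card_mono)
    then show "3 dvd card (\<C> - \<T>)" using mod T(2) by presburger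
    show "pairwise disjnt (\<C> - \<T>)" using disjC by (auto simp: pairwise_def)
  qed (use finC cardC UC assms in auto)
  moreover have "disjnt (insert {a, b} (join_components a b \<T>)) (join_components a b (\<C> - \<T>))"
  proof -
    have "disjnt (\<Union>\<T>) (\<Union>(\<C> - \<T>))"
      using disjC T(1) by (fastforce simp: pairwise_def disjnt_iff)
    then have "disjnt (join_components a b \<T>) (join_components a b (\<C> - \<T>))"
      by (rule join_components_disjnt) (use T UC assms in auto)
    moreover have "{a, b} \<notin> join_components a b (\<C> - \<T>)"
      using assms(4-6) UC by (auto simp: join_components_def cone_def doubleton_eq_iff)
    ultimately show ?thesis by simp
  qed
  ultimately have "decomposable (insert {a, b} (join_components a b \<T>) \<union> join_components a b (\<C> - \<T>))"
    using T(3) by (intro decomposable.union)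
  also have "\<dots> = insert {a, b} (join_components a b (\<T> \<union> (\<C> - \<T>)))"
    by (simp only: join_components_Un Un_insert_left)
  also have "\<T> \<union> (\<C> - \<T>) = \<C>" using T by auto
  also have "join_components a b \<C> = E \<union> cone a b M"
    by (simp add: join_components_def EC UC)
  finally show ?thesis .
qed

section \<open>Joins over arbitrary graphs\<close>

lemma card_Diff_add:
  assumes "finite A" "B \<subseteq> A" "card B = k"
  shows "card A = card (A - B) + k"
  using assms by (metis card_Diff_subset card_mono finite_subset le_add_diff_inverse2)

lemma no_edges_small:
  assumes "\<forall>e\<in>F. e \<subseteq> M \<and> card e = 2" "finite M" "card M < 2"
  shows "F = {}"
  using assms by (metis card_mono equals0I not_less)

text \<open>The reduction step: edges \<open>P\<close> and the edges from \<open>a\<close>,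
  \<open>b\<close> to \<open>N\<close> are split off, and a join of the same kind remains on
  \<open>M - N\<close>. The pieces are disjoint because edges of \<open>E\<close> avoid
  \<open>a\<close> and \<open>b\<close>, while those of a cone do not.\<close>

lemma decomposable_join_split:
  assumes "decomposable (P \<union> cone a b N)"
    and "decomposable (insert {a, b} (E - P \<union> cone a b (M - N)))"
    and "P \<subseteq> E" "N \<subseteq> M" "\<And>e. e \<in> E \<Longrightarrow> e \<inter> {a, b} = {}" "a \<notin> M" "b \<notin> M" "a \<noteq> b"
  shows "decomposable (insert {a, b} (E \<union> cone a b M))"
proof -
  have "e \<noteq> {a, b} \<and> e \<notin> cone a b X" if "e \<in> E" for e X
    using assms(5)[OF that] edge_notin_cone[of e a b X] by blast
  moreover have "a \<notin> N" "b \<notin> N" using assms(4,6,7) by auto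
  then have "{a, b} \<notin> cone a b N" using assms(8) by (simp add: mem_cone_iff)
  moreover have "disjnt (cone a b N) (cone a b (M - N))"
    by (rule cone_disjnt) (use assms(4,6,7) in \<open>auto simp: disjnt_def\<close>)
  ultimately have "disjnt (P \<union> cone a b N) (insert {a, b} (E - P \<union> cone a b (M - N)))"
    using assms(3) unfolding disjnt_def by blast
  with assms(1,2) have "decomposable (P \<union> cone a b N \<union> insert {a, b} (E - P \<union> cone a b (M - N)))"
    by (rule decomposable.union)
  also have "P \<union> cone a b N \<union> insert {a, b} (E - P \<union> cone a b (M - N)) =
      insert {a, b} (E \<union> cone a b (N \<union> (M - N)))"
    unfolding cone_Un using assms(3) by blast
  also have "N \<union> (M - N) = M" using assms(4) by blast
  finally show ?thesis .
qed

text \<open>Strong induction on \<open>card E + card M\<close>. Every reduction removes a multiple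
  of three edges, so divisibility persists. The bound \<open>2 \<le> card M\<close> can fail after a
  reduction; the few graphs where it does are decomposed outright, including
  \<open>ab\<close>.\<close>

lemma join_decomposable:
  assumes "finite M" "\<forall>e\<in>E. e \<subseteq> M \<and> card e = 2" "2 \<le> card M" "3 dvd card E + 2 * card M + 1"
    and "a \<notin> M" "b \<notin> M" "a \<noteq> b"
  shows "decomposable (insert {a, b} (E \<union> cone a b M))"
  using assms(1-6)
proof (induction "card E + card M" arbitrary: E M rule: less_induct)
  case less
  note ab = less.prems(5,6) \<open>a \<noteq> b\<close>
  have finE: "finite E" by (rule finite_subset[of _ "Pow M"]) (use less.prems in auto)
  have edge: "x \<in> M \<and> y \<in> M \<and> x \<noteq> y" if "{x, y} \<in> E" for x y
    using less.prems(2) that by (auto dest: bspec)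
  have edge_form: "\<exists>x y. e = {x, y} \<and> x \<noteq> y" if "e \<in> E" for e
    using less.prems(2) that by (meson card_2_iff)
  have avoid: "e \<inter> {a, b} = {}" if "e \<in> E" for e
    using less.prems(2) that ab by auto
  \<comment> \<open>Either \<open>E\<close> contains a path with three edges, or it contains none
    but has two edges meeting in some \<open>c\<close>, or it is a matching.\<close>
  consider (path) w x y z where "distinct [w, x, y, z]" "{w, x} \<in> E" "{x, y} \<in> E" "{y, z} \<in> E"
    | (cherry) c x y where "x \<noteq> y" "{c, x} \<in> E" "{c, y} \<in> E"
        "\<And>w x y z. \<lbrakk>distinct [w, x, y, z]; {w, x} \<in> E; {x, y} \<in> E; {y, z} \<in> E\<rbrakk> \<Longrightarrow> False"
    | (matching) "\<And>c x y. \<lbrakk>{c, x} \<in> E; {c, y} \<in> E\<rbrakk> \<Longrightarrow> x = y"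
  proof (cases "\<exists>w x y z. distinct [w, x, y, z] \<and> {w, x} \<in> E \<and> {x, y} \<in> E \<and> {y, z} \<in> E")
    case True
    then show ?thesis using that(1) by blast
  next
    case False
    then show ?thesis using that(2,3) by blast
  qed
  then show ?case
  proof cases
    case path
    let ?P = "{{w, x}, {x, y}, {y, z}}"
    have P: "?P \<subseteq> E" "card ?P = 3" using path by (auto simp: doubleton_eq_iff)
    then have card: "card E = card (E - ?P) + 3" using finE by (intro card_Diff_add)
    have dvd: "3 dvd card (E - ?P) + 2 * card M + 1" using less.prems(4) card by presburger
    show ?thesis
    proof (rule decomposable_join_split)
      \<comment> \<open>A path inside \<open>E\<close> is a block by itself, so no vertex of
        \<open>M\<close> is removed.\<close>
      show "decomposable (?P \<union> cone a b {})" using decomposable.path[OF path(1)] by simp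
      have "decomposable (insert {a, b} (E - ?P \<union> cone a b M))"
        by (rule less.hyps) (use dvd less.prems(1-3,5,6) card in auto)
      then show "decomposable (insert {a, b} (E - ?P \<union> cone a b (M - {})))" by simp
    qed (use P avoid ab in auto)
  next
    case cherry
    have dist: "distinct [a, b, c, x, y]" and inM: "c \<in> M" "x \<in> M" "y \<in> M"
      using cherry edge[of c x] edge[of c y] ab by auto
    show ?thesis
    proof (cases "{x, y} \<in> E")
      case True
      let ?P = "{{c, x}, {c, y}, {x, y}}" and ?M = "M - {c, x, y}"
      have P: "?P \<subseteq> E" "card ?P = 3"
        using cherry True dist by (auto simp: doubleton_eq_iff)
      then have cardE: "card E = card (E - ?P) + 3"
        using finE by (intro card_Diff_add)
      have cardM: "card M = card ?M + 3"
      proof -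
        have "card {c, x, y} = 3" "{c, x, y} \<subseteq> M" using dist inM by auto
        then show ?thesis using less.prems(1) by (intro card_Diff_add)
      qed
      have sub: "\<forall>e\<in>E - ?P. e \<subseteq> ?M \<and> card e = 2"
      proof (intro ballI conjI)
        fix e assume e: "e \<in> E - ?P"
        then show "card e = 2" using less.prems by auto
        \<comment> \<open>The triangle is a whole component: an edge leaving it would extend through
          its other two vertices to a path with three edges.\<close>
        have nb: "v \<in> {c, x, y}" if "u \<in> {c, x, y}" "{u, v} \<in> E" for u v
        proof (rule ccontr)
          assume "v \<notin> {c, x, y}"
          then show False
            using that cherry(4)[of v c x y] cherry(4)[of v x c y] cherry(4)[of v y c x]
              cherry(2,3) True dist by (auto simp: insert_commute)
        qed
        obtain p q where pq: "e = {p, q}" "p \<noteq> q" using edge_form e by blast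
        have "p \<notin> {c, x, y} \<and> q \<notin> {c, x, y}"
          using nb[of p q] nb[of q p] e pq by (auto simp: insert_commute)
        then show "e \<subseteq> ?M" using edge[of p q] e pq by auto
      qed
      show ?thesis
      proof (cases "2 \<le> card ?M")
        case True
        \<comment> \<open>The paths \<open>a c x b\<close>, \<open>a x y b\<close> and
          \<open>a y c b\<close>, obtained from one another by rotating the triangle.\<close>
        let ?A = "{{a, c}, {c, x}, {x, b}, {a, x}, {x, y}, {y, b}, {a, y}, {y, c}, {c, b}}"
        have "decomposable ?A"
          using dist by (intro decomposable_insert3 decomposable.empty) (auto simp: doubleton_eq_iff)
        moreover have "?A = ?P \<union> cone a b {c, x, y}" by (simp add: insert_commute)
        ultimately have dec: "decomposable (?P \<union> cone a b {c, x, y})" by simp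
        have dvd: "3 dvd card (E - ?P) + 2 * card ?M + 1"
          using less.prems(4) cardE cardM by presburger
        show ?thesis
        proof (rule decomposable_join_split[OF dec])
          show "decomposable (insert {a, b} (E - ?P \<union> cone a b ?M))"
            by (rule less.hyps) (use dvd less.prems(1,5,6) cardE cardM sub True in auto)
        qed (use P avoid ab inM in auto)
      next
        case False
        have "E - ?P = {}" by (rule no_edges_small[OF sub]) (use less.prems(1) False in auto)
        then have E: "E = ?P" using P by blast
        \<comment> \<open>A lone triangle would leave 3 + 6 + 1 = 10 edges, which is not divisible
          by 3.\<close>
        have "card ?M \<noteq> 0"
        proof
          assume 0: "card ?M = 0"
          have "card E = 3" using P E by metis
          then show False using less.prems(4) cardM 0 by simp
        qed
        then have "card ?M = 1" using False by linarith
        then obtain u where u: "?M = {u}" by (rule card_1_singletonE)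
        then have "u \<in> M" "u \<notin> {c, x, y}" and M: "M = {c, x, y, u}" using inM by auto
        \<comment> \<open>A triangle and one isolated vertex \<open>u\<close>, with
          \<open>ab\<close>: the paths \<open>a b c x\<close>, \<open>a u b x\<close>,
          \<open>a c y x\<close> and \<open>b y a x\<close>.\<close>
        have "decomposable {{a, b}, {b, c}, {c, x}, {a, u}, {u, b}, {b, x}, {a, c}, {c, y}, {y, x},
            {b, y}, {y, a}, {a, x}}"
          using dist \<open>u \<in> M\<close> \<open>u \<notin> _\<close> ab
          by (intro decomposable_insert3 decomposable.empty) (auto simp: doubleton_eq_iff)
        also have "\<dots> = insert {a, b} (E \<union> cone a b M)"
          unfolding M E by (simp add: insert_commute)
        finally show ?thesis .
      qed
    next
      case False
      \<comment> \<open>The centre \<open>c\<close> stays in the graph, since it may have further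
        leaves.\<close>
      let ?P = "{{c, x}, {c, y}}" and ?M = "M - {x, y}"
      have P: "?P \<subseteq> E" "card ?P = 2"
        using cherry dist by (auto simp: doubleton_eq_iff)
      then have cardE: "card E = card (E - ?P) + 2"
        using finE by (intro card_Diff_add)
      have cardM: "card M = card ?M + 2"
      proof -
        have "card {x, y} = 2" "{x, y} \<subseteq> M" using dist inM by auto
        then show ?thesis using less.prems(1) by (intro card_Diff_add)
      qed
      have sub: "\<forall>e\<in>E - ?P. e \<subseteq> ?M \<and> card e = 2"
      proof (intro ballI conjI)
        fix e assume e: "e \<in> E - ?P"
        then show "card e = 2" using less.prems by auto
        \<comment> \<open>Both \<open>x\<close> and \<open>y\<close> are leaves: another neighbour
          \<open>v\<close> of \<open>x\<close> would give the path \<open>v x c y\<close>, and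
          symmetrically for \<open>y\<close>; the edge \<open>xy\<close> is excluded by the
          case.\<close>
        have nb: "v = c" if "u \<in> {x, y}" "{u, v} \<in> E" for u v
        proof (rule ccontr)
          assume "v \<noteq> c"
          then show False
            using that cherry(4)[of v x c y] cherry(4)[of v y c x]
              cherry(2,3) False dist edge[of u v]
            by (cases "v = x"; cases "v = y") (auto simp: insert_commute)
        qed
        obtain p q where pq: "e = {p, q}" "p \<noteq> q" using edge_form e by blast
        have pqE: "{p, q} \<in> E" "{q, p} \<in> E" "{p, q} \<notin> ?P" "{q, p} \<notin> ?P"
          using e by (auto simp: pq(1) insert_commute)
        have "p \<notin> {x, y}" using nb[OF _ pqE(1)] pqE(4) by blast
        moreover have "q \<notin> {x, y}" using nb[OF _ pqE(2)] pqE(3) by blast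
        ultimately show "e \<subseteq> ?M" using edge[of p q] e pq by auto
      qed
      show ?thesis
      proof (cases "2 \<le> card ?M")
        case True
        \<comment> \<open>The paths \<open>x a y c\<close> and \<open>y b x c\<close>.\<close>
        let ?A = "{{x, a}, {a, y}, {y, c}, {y, b}, {b, x}, {x, c}}"
        have "decomposable ?A"
          using dist by (intro decomposable_insert3 decomposable.empty) (auto simp: doubleton_eq_iff)
        moreover have "?A = ?P \<union> cone a b {x, y}" by (simp add: insert_commute)
        ultimately have dec: "decomposable (?P \<union> cone a b {x, y})" by simp
        have dvd: "3 dvd card (E - ?P) + 2 * card ?M + 1"
          using less.prems(4) cardE cardM by presburger
        show ?thesis
        proof (rule decomposable_join_split[OF dec])
          show "decomposable (insert {a, b} (E - ?P \<union> cone a b ?M))"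
            by (rule less.hyps) (use dvd less.prems(1,5,6) cardE cardM sub True in auto)
        qed (use P avoid ab inM in auto)
      next
        case False
        have "E - ?P = {}" by (rule no_edges_small[OF sub]) (use less.prems(1) False in auto)
        then have E: "E = ?P" using P by blast
        \<comment> \<open>Only \<open>c\<close> would remain, and its join with \<open>ab\<close> is
          a triangle, which is not a path. Hence this last cherry is decomposed together with
          \<open>ab\<close>.\<close>
        have "c \<in> ?M" using inM dist by auto
        moreover from this have "card ?M \<noteq> 0" using less.prems(1) by auto
        then have "card ?M = 1" using False by linarith
        ultimately have u: "?M = {c}" by (metis card_1_singletonE singletonD)
        then have M: "M = {c, x, y}" using inM by auto
        \<comment> \<open>The paths \<open>a b c x\<close>, \<open>a c y b\<close> and
          \<open>b x a y\<close>.\<close>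
        have "decomposable {{a, b}, {b, c}, {c, x}, {a, c}, {c, y}, {y, b}, {b, x}, {x, a}, {a, y}}"
          using dist by (intro decomposable_insert3 decomposable.empty) (auto simp: doubleton_eq_iff)
        also have "\<dots> = insert {a, b} (E \<union> cone a b M)"
          unfolding M E by (simp add: insert_commute)
        finally show ?thesis .
      qed
    qed
  next
    case matching
    have "pairwise disjnt E"
    proof (rule pairwiseI)
      fix e f assume ef: "e \<in> E" "f \<in> E" "e \<noteq> f"
      show "disjnt e f"
      proof (rule ccontr)
        assume "\<not> disjnt e f"
        then obtain c where c: "c \<in> e" "c \<in> f" by (auto simp: disjnt_iff)
        then obtain x y where "e = {c, x}" "f = {c, y}"
          using edge_form[OF ef(1)] edge_form[OF ef(2)] by auto
        then show False using matching ef by metis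
      qed
    qed
    then show ?thesis using join_matching_decomposable less.prems ab by metis
  qed
qed

section \<open>Paths as blocks of a design\<close>

lemma path_graph_4:
  "path_graph 4 = Graph {0, 1, 2, 3} {{0, 1}, {1, 2}, {2, 3}}"
proof -
  have "{{i, Suc i} | i. Suc i < 4} = {{0, 1}, {1, 2}, {2, 3}}"
    by (auto simp: numeral_eq_Suc less_Suc_eq)
  moreover have "{..<4} = {0, 1, 2, 3::nat}" by auto
  ultimately show ?thesis by (simp add: path_graph_def)
qed

text \<open>Turns the inductive predicate into an explicit family of paths, from which blocks can be
  formed.\<close>

lemma decomposable_paths:
  assumes "decomposable A"
  shows "\<exists>\<P>. pairwise disjnt \<P> \<and> \<Union>\<P> = A \<and>
    (\<forall>P\<in>\<P>. \<exists>w x y z. distinct [w, x, y, z] \<and> P = {{w, x}, {x, y}, {y, z}})"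
  using assms
proof induction
  case empty
  show ?case by (rule exI[of _ "{}"]) simp
next
  case (path w x y z)
  then show ?case by (intro exI[of _ "{{{w, x}, {x, y}, {y, z}}}"]) auto
next
  case (union A B)
  then obtain \<P> \<Q> where
    P: "pairwise disjnt \<P>" "\<Union>\<P> = A"
      "\<forall>P\<in>\<P>. \<exists>w x y z. distinct [w, x, y, z] \<and> P = {{w, x}, {x, y}, {y, z}}" and
    Q: "pairwise disjnt \<Q>" "\<Union>\<Q> = B"
      "\<forall>P\<in>\<Q>. \<exists>w x y z. distinct [w, x, y, z] \<and> P = {{w, x}, {x, y}, {y, z}}"
    by metis
  have "disjnt C D" if "C \<in> \<P>" "D \<in> \<Q>" for C D
  proof -
    have "C \<subseteq> A" "D \<subseteq> B" using that P(2) Q(2) by auto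
    then show ?thesis using \<open>disjnt A B\<close> by (meson disjnt_subset1 disjnt_subset2)
  qed
  then have "pairwise disjnt (\<P> \<union> \<Q>)"
    using P(1) Q(1) unfolding pairwise_def by (metis Un_iff disjnt_sym)
  then show ?case
    using P Q by (intro exI[of _ "\<P> \<union> \<Q>"] conjI) (simp_all only: ball_Un Union_Un_distrib)
qed

lemma isomorphic_path:
  assumes "distinct [w, x, y, z]"
  shows "isomorphic (Graph {w, x, y, z} {{w, x}, {x, y}, {y, z}}) (path_graph 4)"
  unfolding isomorphic_def path_graph_4
\<comment> \<open>The vertex \<open>w\<close> is sent to the default value 0.\<close>
proof (intro exI[of _ "(\<lambda>_. 0)(x := 1, y := 2, z := 3::nat)"] conjI)
  show "bij_betw ((\<lambda>_. 0)(x := 1, y := 2, z := 3::nat))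
     (verts (Graph {w, x, y, z} {{w, x}, {x, y}, {y, z}})) (verts (Graph {0, 1, 2, 3} {{0, 1}, {1, 2}, {2, 3}}))"
    using assms by (auto simp: bij_betw_def inj_on_def)
  show "edges (Graph {0, 1, 2, 3} {{0, 1}, {1, 2}, {2, 3}}) =
    (`) ((\<lambda>_. 0)(x := 1, y := 2, z := 3::nat)) ` edges (Graph {w, x, y, z} {{w, x}, {x, y}, {y, z}})"
    using assms by auto
qed

text \<open>The counts are transferred from \<open>path_graph 4\<close> along the isomorphism. As it
  is injective on vertices and edges are sets of vertices, it is injective on edges too.\<close>

lemma partial_design_path:
  assumes "partial_design (complete_graph V) (path_graph 4) \<B>" "S \<in> \<B>"
  shows "verts S \<subseteq> V" "edges S \<subseteq> {e. e \<subseteq> V \<and> card e = 2}" "card (edges S) = 3" "card (verts S) = 4"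
proof -
  have S: "simple_graph S" "verts S \<subseteq> V" "edges S \<subseteq> {e. e \<subseteq> V \<and> card e = 2}"
    using assms by (auto simp: partial_design_def subgraph_def complete_graph_def)
  then show "verts S \<subseteq> V" "edges S \<subseteq> {e. e \<subseteq> V \<and> card e = 2}" by auto
  obtain f where f: "bij_betw f (verts S) {0, 1, 2, 3::nat}"
    "{{0, 1}, {1, 2}, {2, 3}} = (`) f ` edges S"
    using assms by (auto simp: partial_design_def isomorphic_def path_graph_4)
  have "inj_on ((`) f) (edges S)"
  proof (rule inj_on_subset)
    show "inj_on ((`) f) (Pow (verts S))"
      using f(1) by (simp add: bij_betw_def inj_on_image_Pow)
    show "edges S \<subseteq> Pow (verts S)" using S(1) by (auto simp: simple_graph_def)
  qed
  from card_image[OF this] have "card (edges S) = card {{0, 1}, {1, 2}, {2, 3::nat}}"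
    unfolding f(2) by (rule sym)
  also have "\<dots> = 3" by (simp add: doubleton_eq_iff)
  finally show "card (edges S) = 3" .
  show "card (verts S) = 4" using bij_betw_same_card[OF f(1)] by simp
qed

section \<open>Numerical conditions for designs\<close>

text \<open>The blocks partition the covered edges into sets of size 3.\<close>

lemma partial_design_card:
  assumes "finite V" "partial_design (complete_graph V) (path_graph 4) \<B>"
  shows "3 dvd card (\<Union>S\<in>\<B>. edges S)"
proof (rule dvd_partition)
  have "(\<Union>S\<in>\<B>. edges S) \<subseteq> Pow V" using partial_design_path(2)[OF assms(2)] by fastforce
  then show "finite (\<Union>S\<in>\<B>. edges S)" using assms(1) by (meson finite_Pow_iff finite_subset)
  show "\<forall>c\<in>edges ` \<B>. 3 dvd card c" using partial_design_path(3)[OF assms(2)] by auto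
  show "\<forall>c1\<in>edges ` \<B>. \<forall>c2\<in>edges ` \<B>. c1 \<noteq> c2 \<longrightarrow> c1 \<inter> c2 = {}"
    using assms(2) by (fastforce simp: partial_design_def pairwise_def disjnt_def)
qed

text \<open>Divisibility comes from counting edges. It would still allow \<open>n = 3\<close>, so
  the second claim uses vertices: as soon as there is an edge, some block covers it and needs four
  vertices.\<close>

lemma admissible_imp:
  assumes "admissible n"
  shows "3 dvd n choose 2" and "n < 2 \<or> 4 \<le> n"
proof -
  obtain \<B> where D: "partial_design (complete_graph {..<n}) (path_graph 4) \<B>"
    "(\<Union>S\<in>\<B>. edges S) = {e. e \<subseteq> {..<n} \<and> card e = 2}"
    using assms by (auto simp: admissible_def design_def complete_graph_def)
  have "card {e. e \<subseteq> {..<n} \<and> card e = 2} = n choose 2" using n_subsets[of "{..<n}" 2] by simp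
  then show "3 dvd n choose 2" using partial_design_card[OF _ D(1)] D(2) by simp
  show "n < 2 \<or> 4 \<le> n"
  proof (rule ccontr)
    assume n: "\<not> (n < 2 \<or> 4 \<le> n)"
    then have "{0, 1} \<in> {e. e \<subseteq> {..<n} \<and> card e = 2}" by auto
    then obtain S where "S \<in> \<B>" using D(2) by blast
    then have "card (verts S) = 4" "verts S \<subseteq> {..<n}" using partial_design_path[OF D(1)] by auto
    then have "4 \<le> n" by (metis card_lessThan card_mono finite_lessThan)
    then show False using n by simp
  qed
qed

section \<open>Completing a partial design\<close>

lemma complete_partial_design:
  assumes pd: "partial_design (complete_graph W) (path_graph 4) \<B>"
    and "decomposable ({e. e \<subseteq> W \<and> card e = 2} - (\<Union>S\<in>\<B>. edges S))"
  shows "\<exists>\<B>'. design (complete_graph W) (path_graph 4) \<B>' \<and> \<B> \<subseteq> \<B>'"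
proof -
  let ?K = "{e. e \<subseteq> W \<and> card e = 2}"
  obtain \<P> where P: "pairwise disjnt \<P>" "\<Union>\<P> = ?K - (\<Union>S\<in>\<B>. edges S)"
    "\<forall>P\<in>\<P>. \<exists>w x y z. distinct [w, x, y, z] \<and> P = {{w, x}, {x, y}, {y, z}}"
    using decomposable_paths[OF assms(2)] by blast
  \<comment> \<open>Each path gets the union of its edges as vertex set, so that no isolated vertex
    spoils the isomorphism with \<open>path_graph 4\<close>.\<close>
  define \<G> where "\<G> = (\<lambda>P. Graph (\<Union>P) P) ` \<P>"
  have "subgraph S (complete_graph W) \<and> isomorphic S (path_graph 4)" if "S \<in> \<G>" for S
  proof -
    from that obtain P where S: "S = Graph (\<Union>P) P" "P \<in> \<P>" by (auto simp: \<G>_def)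
    then obtain w x y z where d: "distinct [w, x, y, z]" and Pe: "P = {{w, x}, {x, y}, {y, z}}"
      using P(3)[rule_format, OF S(2)] by blast
    have "P \<subseteq> ?K" using P(2) S by blast
    then have "subgraph S (complete_graph W)"
      by (auto simp: S subgraph_def complete_graph_def simple_graph_def)
    moreover have "\<Union>P = {w, x, y, z}" by (auto simp: Pe)
    ultimately show ?thesis using isomorphic_path[OF d] by (simp add: S Pe)
  qed
  moreover have "pairwise (\<lambda>S T. disjnt (edges S) (edges T)) (\<B> \<union> \<G>)"
  proof -
    have "disjnt (edges S) (edges T)" if "S \<in> \<B>" "T \<in> \<G>" for S T
      using that P(2) by (fastforce simp: \<G>_def disjnt_iff)
    moreover have "disjnt (edges S) (edges T)" if ST: "S \<in> \<G>" "T \<in> \<G>" "S \<noteq> T" for S T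
    proof -
      obtain P Q where "S = Graph (\<Union>P) P" "P \<in> \<P>" "T = Graph (\<Union>Q) Q" "Q \<in> \<P>"
        using ST(1,2) unfolding \<G>_def by blast
      then show ?thesis using ST(3) pairwiseD[OF P(1), of P Q] by auto
    qed
    ultimately show ?thesis using pd unfolding partial_design_def pairwise_def
      by (metis Un_iff disjnt_sym)
  qed
  moreover have "(\<Union>S\<in>\<B> \<union> \<G>. edges S) = ?K"
  proof -
    have "(\<Union>S\<in>\<G>. edges S) = \<Union>\<P>" by (simp add: \<G>_def)
    moreover have "(\<Union>S\<in>\<B>. edges S) \<subseteq> ?K" using partial_design_path(2)[OF pd] by blast
    ultimately show ?thesis using P(2) by auto
  qed
  ultimately have "design (complete_graph W) (path_graph 4) (\<B> \<union> \<G>)"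
    using pd by (auto simp: design_def partial_design_def complete_graph_def)
  then show ?thesis by blast
qed

theorem theorem3p1:
  fixes V W :: "'a set" and v n :: nat and \<B> :: "'a graph set"
  assumes "finite V" and "card V = v"
    and "partial_design (complete_graph V) (path_graph 4) \<B>"
    and "admissible n" and "n \<ge> v + 2"
    and "finite W" and "card W = n" and "V \<subseteq> W"
  shows "\<exists>\<B>'. design (complete_graph W) (path_graph 4) \<B>' \<and>
           embedded (complete_graph V) \<B> (complete_graph W) \<B>'"
proof -
  let ?K = "{e. e \<subseteq> W \<and> card e = 2}" and ?U = "\<Union>S\<in>\<B>. edges S"
  have "card (W - V) = n - v" using assms by (simp add: card_Diff_subset)
  then have "2 \<le> card (W - V)" using assms(5) by simp
  then obtain T where "T \<subseteq> W - V" "card T = 2" using obtain_subset_with_card_n by metis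
  then obtain a b where ab: "a \<in> W - V" "b \<in> W - V" "a \<noteq> b" by (auto simp: card_2_iff)
  define M where "M = W - {a, b}"
  define E where "E = {e. e \<subseteq> M \<and> card e = 2} - ?U"
  have W: "W = insert a (insert b M)" and abM: "a \<notin> M" "b \<notin> M"
    using ab by (auto simp: M_def)
  have finM: "finite M" using assms(6) by (simp add: M_def)
  have cardM: "card W = card M + 2" using abM ab finM by (simp add: W)
  have UV: "?U \<subseteq> {e. e \<subseteq> V \<and> card e = 2}" using partial_design_path(2)[OF assms(3)] by blast
  have VM: "V \<subseteq> M" using ab assms(8) by (auto simp: M_def)
  \<comment> \<open>Every edge at \<open>a\<close> or \<open>b\<close> is still uncovered, as the
    blocks live inside \<open>V\<close>. So the uncovered edges are exactly the join of
    \<open>E\<close> with the edge \<open>ab\<close>.\<close>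
  have K: "?K = ?U \<union> insert {a, b} (E \<union> cone a b M)"
  proof
    show "?K \<subseteq> ?U \<union> insert {a, b} (E \<union> cone a b M)"
    proof
      fix e assume "e \<in> ?K"
      then obtain x y where "e = {x, y}" "x \<noteq> y" "x \<in> W" "y \<in> W" by (auto simp: card_2_iff)
      then show "e \<in> ?U \<union> insert {a, b} (E \<union> cone a b M)"
        by (auto simp: W E_def cone_def insert_commute)
    qed
    show "?U \<union> insert {a, b} (E \<union> cone a b M) \<subseteq> ?K"
    proof -
      have "?U \<subseteq> ?K" using UV assms(8) by blast
      moreover have "insert {a, b} (E \<union> cone a b M) \<subseteq> ?K"
        using abM ab by (auto simp: E_def cone_def W card_2_iff)
      ultimately show ?thesis by blast
    qed
  qed
  have nab: "a \<notin> e \<and> b \<notin> e" if "e \<in> ?U \<union> E" for e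
    using that UV VM abM by (auto simp: E_def)
  have ncone: "e \<notin> cone a b M" if "e \<in> ?U \<union> E" for e
    by (rule edge_notin_cone) (use nab[OF that] in blast)
  have "{a, b} \<notin> ?U" using nab[of "{a, b}"] by blast
  moreover have "?U \<inter> E = {}" by (auto simp: E_def)
  ultimately have disj: "disjnt ?U (insert {a, b} (E \<union> cone a b M))"
    using ncone unfolding disjnt_def by blast
  have fin: "finite ?U" "finite E"
  proof -
    have "finite ?K" using assms(6) by simp
    then show "finite ?U" "finite E" using K by (metis finite_Un finite_insert)+
  qed
  have "card ?K = card ?U + card (insert {a, b} (E \<union> cone a b M))"
    unfolding K by (rule card_Un_disjoint) (use fin disj card_cone finM abM ab in \<open>auto simp: disjnt_def\<close>)
  also have "card (insert {a, b} (E \<union> cone a b M)) = card (E \<union> cone a b M) + 1"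
  proof -
    have "{a, b} \<notin> E \<union> cone a b M" using nab ab abM by (auto simp: mem_cone_iff)
    then show ?thesis using fin card_cone(1)[OF finM abM] ab by simp
  qed
  also have "card (E \<union> cone a b M) = card E + 2 * card M"
  proof -
    have "E \<inter> cone a b M = {}" using ncone by blast
    then show ?thesis using fin card_cone[OF finM abM] ab by (simp add: card_Un_disjoint)
  qed
  finally have "card ?K = card ?U + (card E + 2 * card M + 1)" by simp
  \<comment> \<open>Both the complete graph and the covered part have a multiple of three edges,
    hence so has the uncovered rest.\<close>
  moreover have "3 dvd card ?K"
    using n_subsets[OF assms(6), of 2] admissible_imp(1)[OF assms(4)] assms(7) by simp
  ultimately have "3 dvd card E + 2 * card M + 1"
    using partial_design_card[OF assms(1,3)] by (metis dvd_add_right_iff)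
  \<comment> \<open>From \<open>n \<ge> v + 2\<close> one gets \<open>n \<ge> 2\<close>, and
    admissibility then raises this to \<open>n \<ge> 4\<close>, while
    \<open>card M = n - 2\<close>.\<close>
  moreover have "2 \<le> card M" using admissible_imp(2)[OF assms(4)] assms(5,7) cardM by linarith
  ultimately have "decomposable (insert {a, b} (E \<union> cone a b M))"
    using finM abM ab by (intro join_decomposable) (auto simp: E_def)
  also have "insert {a, b} (E \<union> cone a b M) = ?K - ?U" using K disj by (auto simp: disjnt_iff)
  finally have "decomposable (?K - ?U)" .
  moreover have "partial_design (complete_graph W) (path_graph 4) \<B>"
    using assms(3,8) by (fastforce simp: partial_design_def subgraph_def complete_graph_def)
  ultimately show ?thesis
    using complete_partial_design assms(8) by (fastforce simp: embedded_def complete_graph_def)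
qed

end
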